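(* Let $(X,d_X)$ be a starry metric space and let $(Y,d_Y)$ be a doubling metric space. Let $\alpha\in(0,1]$, let $\Psi\colon(0,\infty)\to(0,\infty)$ be an increasing function, and let $\phi\colon X\to Y$ be an embedding of $X$ into $Y$. Then it is not the case that $$\frac{d_Y(\phi(x),\phi(y))}{d_Y(\phi(x),\phi(z))}\le\Psi\left(\frac{d_X(x,y)^\alpha}{d_X(x,z)^\alpha}\right)$$ holds for all distinct $x,y,z\in X$.
   Context: **Approximate stars.** Let $A>1$ and $0<\eta<1$ satisfy $A-\eta>1+\eta$ (equivalently $\eta<(A-1)/2$). A metric space $(X,d)$ contains an $(A,\eta)$-approximate $n$-star if there exist $\varrho>0$ and points $x_0,\dots,x_n\in X$ such that $(A-\eta)\varrho\le d(x_i,x_j)\le A\varrho$ for all $i,j\in\{1,\dots,n\}$ with $i\ne j$, and $\varrho\le d(x_0,x_i)\le(1+\eta)\varrho$ for all $i\in\{1,\dots,n\}$. **Starry.** $(X,d)$ is starry if there exist $A>1$ and $0<\eta<(A-1)/2$ (independent of $n$) such that for every $n\in\mathbb N$ there is $A_n\ge A$ for which $(X,d)$ contains an $(A_n,\eta)$-approximate $n$-star. **Doubling.** A metric space $X$ is doubling if there is a constant $K>0$ such that for all $x\in X$ and $r>0$ the closed ball $B(x,r)$ can be covered by at most $K$ balls of radius $r/2$. An embedding is a homeomorphism onto its image. *)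

theory Defs
  imports "HOL-Analysis.Analysis"
begin

context Metric_space
begin

text \<open>The standing conditions on the parameters \<open>A\<close> and \<open>\<eta>\<close> are part of the predicate, so the
  notion is only ever satisfied for admissible parameters. The point \<open>x 0\<close> is the centre of the
  star; values \<open>x i\<close> with \<open>i > n\<close> are irrelevant.\<close>

definition contains_approximate_star :: "real \<Rightarrow> real \<Rightarrow> nat \<Rightarrow> bool" where
  "contains_approximate_star A \<eta> n \<longleftrightarrow>
     1 < A \<and> 0 < \<eta> \<and> \<eta> < 1 \<and> 1 + \<eta> < A - \<eta> \<and>
     (\<exists>\<rho>>0. \<exists>x :: nat \<Rightarrow> 'a.
        (\<forall>i\<in>{0..n}. x i \<in> M) \<and>
        (\<forall>i\<in>{1..n}. \<forall>j\<in>{1..n}. i \<noteq> j \<longrightarrow>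
           (A - \<eta>) * \<rho> \<le> d (x i) (x j) \<and> d (x i) (x j) \<le> A * \<rho>) \<and>
        (\<forall>i\<in>{1..n}. \<rho> \<le> d (x 0) (x i) \<and> d (x 0) (x i) \<le> (1 + \<eta>) * \<rho>))"

definition starry :: bool where
  "starry \<longleftrightarrow>
     (\<exists>A \<eta>. 1 < A \<and> 0 < \<eta> \<and> \<eta> < (A - 1) / 2 \<and>
        (\<forall>n. \<exists>A'\<ge>A. contains_approximate_star A' \<eta> n))"

definition doubling :: bool where
  "doubling \<longleftrightarrow>
     (\<exists>K::nat. 0 < K \<and>
        (\<forall>x\<in>M. \<forall>r>0. \<exists>C\<subseteq>M. finite C \<and> card C \<le> K \<and>
           mcball x r \<subseteq> (\<Union>c\<in>C. mcball c (r / 2))))"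

end

end

theory Submission
  imports Defs
begin

text \<open>In a star the relevant distance ratios are at most \<open>2\<close>, so the inequality makes the distances of the
  image points from the image of the centre, and the mutual distances of the image points,
  comparable up to a constant that does not depend on the star. A doubling space contains only
  boundedly many points that are separated at a scale comparable to the radius of a ball
  containing them, so stars with sufficiently many points are excluded.\<close>

text \<open>Each halving of the radius multiplies the number of balls by at most \<open>K\<close>.
  The centres stay in \<open>M\<close>, so the covering property can be applied to them
  again.\<close>

lemma (in Metric_space) doubling_iterated_cover:
  assumes K: "\<And>x r. x \<in> M \<Longrightarrow> 0 < r \<Longrightarrow>
      \<exists>C\<subseteq>M. finite C \<and> card C \<le> (K::nat) \<and> mcball x r \<subseteq> (\<Union>c\<in>C. mcball c (r / 2))"
    and x: "x \<in> M" and r: "0 < r"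
  shows "\<exists>C\<subseteq>M. finite C \<and> card C \<le> K ^ k \<and> mcball x r \<subseteq> (\<Union>c\<in>C. mcball c (r / 2 ^ k))"
proof (induction k)
  case 0
  show ?case
    using x by (intro exI[of _ "{x}"]) auto
next
  case (Suc k)
  then obtain C where C: "C \<subseteq> M" "finite C" "card C \<le> K ^ k"
      "mcball x r \<subseteq> (\<Union>c\<in>C. mcball c (r / 2 ^ k))"
    by blast
  have "\<forall>c\<in>C. \<exists>D\<subseteq>M. finite D \<and> card D \<le> K \<and>
      mcball c (r / 2 ^ k) \<subseteq> (\<Union>e\<in>D. mcball e (r / 2 ^ k / 2))"
    using C(1) r by (intro ballI K) auto
  then obtain D where D: "\<And>c. c \<in> C \<Longrightarrow> D c \<subseteq> M \<and> finite (D c) \<and> card (D c) \<le> K \<and>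
      mcball c (r / 2 ^ k) \<subseteq> (\<Union>e\<in>D c. mcball e (r / 2 ^ k / 2))"
    by metis
  have "card (\<Union>(D ` C)) \<le> (\<Sum>c\<in>C. card (D c))"
    by (rule card_UN_le[OF C(2)])
  also have "\<dots> \<le> card C * K"
    using sum_bounded_above[of C "\<lambda>c. card (D c)" K] D by auto
  also have "\<dots> \<le> K ^ Suc k"
    using mult_right_mono[OF C(3), of K] by (simp add: mult.commute)
  finally have card: "card (\<Union>(D ` C)) \<le> K ^ Suc k" .
  have half: "r / 2 ^ k / 2 = r / 2 ^ Suc k"
    by simp
  have "mcball x r \<subseteq> (\<Union>e\<in>\<Union>(D ` C). mcball e (r / 2 ^ Suc k))"
  proof
    fix y assume "y \<in> mcball x r"
    then obtain c where c: "c \<in> C" "y \<in> mcball c (r / 2 ^ k)"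
      using C(4) by blast
    then obtain e where "e \<in> D c" "y \<in> mcball e (r / 2 ^ Suc k)"
      using D[OF c(1)] unfolding half by blast
    then show "y \<in> (\<Union>e\<in>\<Union>(D ` C). mcball e (r / 2 ^ Suc k))"
      using c(1) by blast
  qed
  moreover have "\<Union>(D ` C) \<subseteq> M" "finite (\<Union>(D ` C))"
    using D C(2) by blast+
  ultimately show ?case
    using card by blast
qed

text \<open>Pigeonhole: once the covering balls are smaller than the separation, each holds at most
  one point of \<open>S\<close>. The bound \<open>N\<close> is fixed before \<open>x\<close>,
  \<open>r\<close> and \<open>S\<close>, so it depends only on the space and on
  \<open>q\<close>.\<close>

lemma (in Metric_space) doubling_card_separated_le:
  assumes "doubling" and q: "0 < q"
  obtains N where "\<And>x r S. x \<in> M \<Longrightarrow> 0 < r \<Longrightarrow> S \<subseteq> mcball x r \<Longrightarrow>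
    pairwise (\<lambda>a b. q * r \<le> d a b) S \<Longrightarrow> finite S \<and> card S \<le> N"
proof -
  obtain K :: nat where K: "\<And>x r. x \<in> M \<Longrightarrow> 0 < r \<Longrightarrow>
      \<exists>C\<subseteq>M. finite C \<and> card C \<le> K \<and> mcball x r \<subseteq> (\<Union>c\<in>C. mcball c (r / 2))"
    using \<open>doubling\<close> unfolding doubling_def by blast
  \<comment> \<open>This is \<open>2 * (r / 2 ^ k) < q * r\<close>: two points in a common small
    ball are closer than the separation allows.\<close>
  obtain k where k: "2 / q < 2 ^ k"
    using real_arch_pow[of 2 "2 / q"] by auto
  have "finite S \<and> card S \<le> K ^ k"
    if x: "x \<in> M" and r: "0 < r" and S: "S \<subseteq> mcball x r"
      and sep: "pairwise (\<lambda>a b. q * r \<le> d a b) S" for x r S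
  proof -
    obtain C where C: "finite C" "card C \<le> K ^ k"
        "mcball x r \<subseteq> (\<Union>c\<in>C. mcball c (r / 2 ^ k))"
      using doubling_iterated_cover[OF K x r, of k] by blast
    have "\<forall>s\<in>S. \<exists>c\<in>C. s \<in> mcball c (r / 2 ^ k)"
      using C(3) S by blast
    then obtain f where f: "\<And>s. s \<in> S \<Longrightarrow> f s \<in> C \<and> s \<in> mcball (f s) (r / 2 ^ k)"
      by metis
    have "inj_on f S"
    proof (rule inj_onI, rule ccontr)
      fix s t assume st: "s \<in> S" "t \<in> S" "f s = f t" "s \<noteq> t"
      have "d s t \<le> d (f s) s + d (f s) t"
        using f[OF st(1)] f[OF st(2)] st(3) triangle[of s "f s" t] by (auto simp: commute)
      also have "\<dots> \<le> r / 2 ^ k + r / 2 ^ k"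
        using f[OF st(1)] f[OF st(2)] st(3) by (intro add_mono) auto
      also have "\<dots> < q * r"
        using k q r by (simp add: field_simps)
      finally show False
        using sep st by (meson not_le pairwiseD)
    qed
    moreover have "f ` S \<subseteq> C"
      using f by blast
    ultimately show ?thesis
      using C(1,2) card_inj_on_le finite_imageD finite_subset order_trans by metis
  qed
  with that show thesis
    by blast
qed

theorem corollary2p6:
  fixes X :: "'a set" and d\<^sub>X :: "'a \<Rightarrow> 'a \<Rightarrow> real"
    and Y :: "'b set" and d\<^sub>Y :: "'b \<Rightarrow> 'b \<Rightarrow> real"
    and \<alpha> :: real and \<Psi> :: "real \<Rightarrow> real" and \<phi> :: "'a \<Rightarrow> 'b"
  assumes "Metric_space X d\<^sub>X" and "Metric_space.starry X d\<^sub>X"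
    and "Metric_space Y d\<^sub>Y" and "Metric_space.doubling Y d\<^sub>Y"
    and "0 < \<alpha>" and "\<alpha> \<le> 1"
    and "\<Psi> \<in> {0<..} \<rightarrow> {0<..}" and "mono_on {0<..} \<Psi>"
    and "embedding_map (Metric_space.mtopology X d\<^sub>X) (Metric_space.mtopology Y d\<^sub>Y) \<phi>"
  shows "\<not> (\<forall>x\<in>X. \<forall>y\<in>X. \<forall>z\<in>X. x \<noteq> y \<and> x \<noteq> z \<and> y \<noteq> z \<longrightarrow>
           d\<^sub>Y (\<phi> x) (\<phi> y) / d\<^sub>Y (\<phi> x) (\<phi> z)
             \<le> \<Psi> (d\<^sub>X x y powr \<alpha> / d\<^sub>X x z powr \<alpha>))"
proof
  interpret X: Metric_space X d\<^sub>X by fact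
  interpret Y: Metric_space Y d\<^sub>Y by fact
  assume *: "\<forall>x\<in>X. \<forall>y\<in>X. \<forall>z\<in>X. x \<noteq> y \<and> x \<noteq> z \<and> y \<noteq> z \<longrightarrow>
           d\<^sub>Y (\<phi> x) (\<phi> y) / d\<^sub>Y (\<phi> x) (\<phi> z)
             \<le> \<Psi> (d\<^sub>X x y powr \<alpha> / d\<^sub>X x z powr \<alpha>)"
  have \<phi>: "\<phi> \<in> X \<rightarrow> Y" "inj_on \<phi> X"
    using continuous_map_funspace[OF homeomorphic_imp_continuous_map]
      homeomorphic_imp_injective_map assms(9) unfolding embedding_map_def
    by fastforce+
  \<comment> \<open>\<open>\<Psi> 2\<close> handles all ratios up to 2. The maximum with 1 covers
    the case of equal second and third points and allows multiplication by \<open>C\<close>.\<close>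
  define C where "C = max 1 (\<Psi> 2)"
  have C: "1 \<le> C" "\<Psi> 2 \<le> C"
    by (auto simp: C_def)
  have comparable: "d\<^sub>Y (\<phi> x) (\<phi> y) \<le> C * d\<^sub>Y (\<phi> x) (\<phi> z)"
    if mem: "x \<in> X" "y \<in> X" "z \<in> X" "x \<noteq> y" "x \<noteq> z" and le: "d\<^sub>X x y \<le> 2 * d\<^sub>X x z" for x y z
  \<comment> \<open>The assumed inequality speaks only of distinct points, but equal ones do occur:
    \<delta>_le is later used with both indices equal to 1.\<close>
  proof (cases "y = z")
    case True
    then show ?thesis
      using C(1) mult_right_mono[of 1 C "d\<^sub>Y (\<phi> x) (\<phi> z)"] by simp
  next
    case False
    let ?t = "d\<^sub>X x y powr \<alpha> / d\<^sub>X x z powr \<alpha>"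
    have pos: "0 < d\<^sub>X x y" "0 < d\<^sub>X x z"
      using mem X.mdist_pos_less by auto
    have "?t = (d\<^sub>X x y / d\<^sub>X x z) powr \<alpha>"
      using pos by (simp add: powr_divide)
    also have "\<dots> \<le> 2 powr \<alpha>"
      using pos le \<open>0 < \<alpha>\<close> by (intro powr_mono2) (auto simp: field_simps)
    \<comment> \<open>Since \<alpha> is at most 1, the power of a ratio bounded by 2 is again
      bounded by 2, so monotonicity of \<Psi> gives the bound \<open>\<Psi> 2\<close>.\<close>
    also have "\<dots> \<le> 2 powr 1"
      using \<open>\<alpha> \<le> 1\<close> by (intro powr_mono) auto
    finally have "?t \<le> 2"
      by simp
    then have "\<Psi> ?t \<le> C"
      using pos C(2) mono_onD[OF assms(8), of ?t 2] by auto
    then have "d\<^sub>Y (\<phi> x) (\<phi> y) / d\<^sub>Y (\<phi> x) (\<phi> z) \<le> C"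
      using * mem False order_trans by blast
    moreover have "0 < d\<^sub>Y (\<phi> x) (\<phi> z)"
      using mem \<phi> by (intro Y.mdist_pos_less) (auto dest: inj_onD)
    ultimately show ?thesis
      by (simp add: divide_le_eq)
  qed
  \<comment> \<open>The image points will lie in a ball of radius \<open>C * \<delta> 1\<close> with
    mutual distances at least \<open>\<delta> 1 / (C * C)\<close>; the quotient is this constant. It
    does not depend on the star, so \<open>N\<close> can be chosen first and a star with
    \<open>Suc N\<close> outer points taken afterwards.\<close>
  have "0 < 1 / (C * C * C)"
    using C(1) by simp
  then obtain N where N: "\<And>y r S. y \<in> Y \<Longrightarrow> 0 < r \<Longrightarrow> S \<subseteq> Y.mcball y r \<Longrightarrow>
      pairwise (\<lambda>a b. 1 / (C * C * C) * r \<le> d\<^sub>Y a b) S \<Longrightarrow> finite S \<and> card S \<le> N"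
    using Y.doubling_card_separated_le[OF assms(4)] by metis
  obtain A \<eta> where "X.contains_approximate_star A \<eta> (Suc N)"
    using assms(2) unfolding X.starry_def by blast
  then obtain \<rho> x where \<eta>: "0 < \<eta>" "\<eta> < 1" "1 + \<eta> < A - \<eta>" and \<rho>: "0 < \<rho>"
    and xX: "\<And>i. i \<in> {0..Suc N} \<Longrightarrow> x i \<in> X"
    and rim: "\<And>i j. i \<in> {1..Suc N} \<Longrightarrow> j \<in> {1..Suc N} \<Longrightarrow> i \<noteq> j \<Longrightarrow>
      (A - \<eta>) * \<rho> \<le> d\<^sub>X (x i) (x j)"
    and centre: "\<And>i. i \<in> {1..Suc N} \<Longrightarrow>
      \<rho> \<le> d\<^sub>X (x 0) (x i) \<and> d\<^sub>X (x 0) (x i) \<le> (1 + \<eta>) * \<rho>"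
    unfolding X.contains_approximate_star_def by metis
  have x0: "x 0 \<in> X" and xi: "\<And>i. i \<in> {1..Suc N} \<Longrightarrow> x i \<in> X"
    using xX by auto
  have ne0: "x 0 \<noteq> x i" if "i \<in> {1..Suc N}" for i
    using centre[OF that] \<rho> X.mdist_zero[OF x0] by auto
  have le2: "(1 + \<eta>) * \<rho> \<le> 2 * \<rho>"
    using \<eta> \<rho> by simp
  \<comment> \<open>By \<open>1 + \<eta> < A - \<eta>\<close>, outer points are farther from each
    other than from the centre.\<close>
  have gt: "(1 + \<eta>) * \<rho> < d\<^sub>X (x i) (x j)"
    if "i \<in> {1..Suc N}" "j \<in> {1..Suc N}" "i \<noteq> j" for i j
    using rim[OF that] \<eta>(3) \<rho> mult_strict_right_mono by (smt (verit))
  have ne: "x i \<noteq> x j" if "i \<in> {1..Suc N}" "j \<in> {1..Suc N}" "i \<noteq> j" for i j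
    using gt[OF that] X.mdist_zero[OF xi] that \<eta>(1) \<rho> mult_pos_pos[of "1 + \<eta>" \<rho>] by fastforce
  define \<delta> where "\<delta> i = d\<^sub>Y (\<phi> (x 0)) (\<phi> (x i))" for i
  \<comment> \<open>Comparison based at the centre, where all distances to outer points lie between
    \<rho> and \<open>2 * \<rho>\<close>.\<close>
  have \<delta>_le: "\<delta> i \<le> C * \<delta> j" if "i \<in> {1..Suc N}" "j \<in> {1..Suc N}" for i j
    unfolding \<delta>_def using centre[OF that(1)] centre[OF that(2)] le2 that
    by (intro comparable x0 xi ne0) auto
  \<comment> \<open>Comparison based at the outer point \<open>x i\<close>: the centre is nearer to
    it than \<open>x j\<close>, so the image of \<open>x j\<close> cannot be much nearer than the
    image of the centre.\<close>
  have \<delta>_sep: "\<delta> i \<le> C * d\<^sub>Y (\<phi> (x i)) (\<phi> (x j))"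
    if "i \<in> {1..Suc N}" "j \<in> {1..Suc N}" "i \<noteq> j" for i j
  proof -
    have "d\<^sub>X (x i) (x 0) \<le> 2 * d\<^sub>X (x i) (x j)"
      using gt[OF that] centre[OF that(1)] X.nonneg[of "x i" "x j"] X.commute[of "x i" "x 0"]
      by linarith
    then have "d\<^sub>Y (\<phi> (x i)) (\<phi> (x 0)) \<le> C * d\<^sub>Y (\<phi> (x i)) (\<phi> (x j))"
      using that by (intro comparable x0 xi ne ne0[symmetric])
    then show ?thesis
      by (simp add: \<delta>_def Y.commute)
  qed
  let ?S = "(\<lambda>i. \<phi> (x i)) ` {1..Suc N}"
  have one: "1 \<in> {1..Suc N}"
    by simp
  have \<delta>1: "0 < \<delta> 1"
    unfolding \<delta>_def using ne0[OF one] x0 xi[OF one] \<phi>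
    by (intro Y.mdist_pos_less) (auto dest: inj_onD)
  have "pairwise (\<lambda>a b. 1 / (C * C * C) * (C * \<delta> 1) \<le> d\<^sub>Y a b) ?S"
  proof (rule pairwise_imageI)
    fix i j assume ij: "i \<in> {1..Suc N}" "j \<in> {1..Suc N}" "i \<noteq> j"
    have "\<delta> 1 \<le> C * \<delta> i"
      by (rule \<delta>_le[OF one ij(1)])
    also have "\<dots> \<le> C * (C * d\<^sub>Y (\<phi> (x i)) (\<phi> (x j)))"
      using \<delta>_sep[OF ij] C(1) by (intro mult_left_mono) auto
    finally show "1 / (C * C * C) * (C * \<delta> 1) \<le> d\<^sub>Y (\<phi> (x i)) (\<phi> (x j))"
      using C(1) by (simp add: field_simps)
  qed
  moreover have "?S \<subseteq> Y.mcball (\<phi> (x 0)) (C * \<delta> 1)"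
    using \<delta>_le[OF _ one] x0 xi funcset_mem[OF \<phi>(1)] by (auto simp: \<delta>_def)
  ultimately have "card ?S \<le> N"
    using N[of "\<phi> (x 0)" "C * \<delta> 1" ?S] x0 \<phi>(1) \<delta>1 C(1) by auto
  \<comment> \<open>The image therefore has \<open>Suc N\<close> points, one more than the packing
    bound permits.\<close>
  moreover have "inj_on (\<lambda>i. \<phi> (x i)) {1..Suc N}"
    using ne xi \<phi>(2) by (intro inj_onI) (metis inj_onD)
  ultimately show False
    by (simp add: card_image)
qed

end
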